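(* Let $\phi$ be an analytic self-map of the upper half-plane $\mathbb{H}$ of parabolic type with Denjoy-Wolff point $\tau_\phi=\infty$. Let $\{w_n=x_n+iy_n\}_{n=0}^{\infty}$ be a backward-iteration sequence for $\phi$ tending to $\infty$, with bounded pseudo-hyperbolic steps $d_n=d(w_n,w_{n+1})\uparrow a<1$, and which is furthermore of non-zero-height, i.e. $y_n\downarrow\ell_\infty>0$. Let $\{\tilde w_n=\tilde x_n+i\tilde y_n\}_{n=0}^{\infty}$ be another backward-iteration sequence for $\phi$ tending to $\infty$ with $d(\tilde w_n,\tilde w_{n+1})\uparrow\tilde a<1$ and $\tilde y_n\downarrow\tilde\ell_\infty>0$. Assume further that $\operatorname{Arg} w_n$ and $\operatorname{Arg}\tilde w_n$ both tend to zero. Let $\tau_n(z)=x_n+y_nz$, $\tilde\tau_n(z)=\tilde x_n+\tilde y_nz$, $b_0=\frac{2a}{\sqrt{1-a^2}}$, $\tilde b_0=\frac{2\tilde a}{\sqrt{1-\tilde a^2}}$, and let $\psi=\lim_{n\to\infty}\phi_n\circ\tau_n$ and $\tilde\psi=\lim_{n\to\infty}\phi_n\circ\tilde\tau_n$ be the corresponding conjugating maps. Then $$\tilde\psi\left(\frac{\tilde b_0}{b_0}z+b_1\right)=\psi(z)\qquad(z\in\mathbb{H})$$ for some $b_1\in\mathbb{R}$. So that $\tilde w_n=\psi(z_1+nb_0)$ for $z_1=(b_0/\tilde b_0)(i-b_1)$, and $$\lim_{n\to\infty}(x_{n+1}-x_n)=\ell_\infty\frac{2a}{\sqrt{1-a^2}}=\tilde\ell_\infty\frac{2\tilde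 a}{\sqrt{1-\tilde a^2}}=\lim_{n\to\infty}(\tilde x_{n+1}-\tilde x_n).$$
   Context: $\mathbb{H}=\{z\in\mathbb{C}:\operatorname{Im} z>0\}$, and $d(z,w)=\left|\frac{w-z}{w-\overline{z}}\right|$ is the pseudo-hyperbolic distance on $\mathbb{H}$. An analytic self-map $\phi$ of $\mathbb{H}$ is of parabolic type with Denjoy-Wolff point $\infty$ if $\phi(z)\to\infty$ and $\phi(z)/z\to 1$ as $z\to\infty$ non-tangentially, that is, within each sector $\{|\operatorname{Arg} z-\pi/2|<\theta_0\}$, $\theta_0\in(0,\pi/2)$. A backward-iteration sequence for $\phi$ is a sequence $\{w_n\}_{n\ge0}\subset\mathbb{H}$ with $\phi(w_{n+1})=w_n$ for all $n\ge 0$. $\phi_n$ denotes the $n$-th iterate of $\phi$; $\uparrow$ and $\downarrow$ denote monotone (non-decreasing, resp. non-increasing) convergence. It is known (another theorem of the paper) that if $\{w_n=x_n+iy_n\}$ is a backward-iteration sequence tending to infinity with $d(w_n,w_{n+1})\uparrow a<1$ and $\operatorname{Arg} w_n\to0$, then $\phi_n\circ\tau_n$, with $\tau_n(z)=x_n+y_nz$, converges uniformly on compact subsets of $\mathbb{H}$ to an analytic self-map $\psi$ of $\mathbb{H}$ with $\psi(z-b_0)=\phi\circ\psi(z)$, where $b_0=\frac{2a}{\sqrt{1-a^2}}=\lim_n\frac{x_{n+1}-x_n}{y_n}$; this is the conjugating map $\psi$ referred to in the claim. *)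

theory Defs
  imports "HOL-Complex_Analysis.Complex_Analysis"
begin

definition upper_half_plane :: "complex set"
  where "upper_half_plane = {z. Im z > 0}"

definition pseudo_hyp_dist :: "complex \<Rightarrow> complex \<Rightarrow> real"
  where "pseudo_hyp_dist z w = cmod ((w - z) / (w - cnj z))"

text \<open>On the open set \<open>upper_half_plane\<close>, holomorphic is the same as analytic. Values of
  \<open>\<phi>\<close> outside the half-plane are irrelevant.\<close>

definition analytic_self_map :: "(complex \<Rightarrow> complex) \<Rightarrow> bool"
  where "analytic_self_map \<phi> \<longleftrightarrow>
    \<phi> holomorphic_on upper_half_plane \<and> \<phi> ` upper_half_plane \<subseteq> upper_half_plane"

text \<open>The filter \<open>z \<rightarrow> \<infinity>\<close> restricted to the sector of half-opening \<open>\<theta>\<close> around the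
  positive imaginary axis; for \<open>\<theta> < pi / 2\<close> the sector lies in the upper half-plane.
  Non-tangential limits at infinity are limits along all of these filters.\<close>

definition at_infinity_sector :: "real \<Rightarrow> complex filter"
  where "at_infinity_sector \<theta> = inf at_infinity (principal {z. \<bar>Arg z - pi / 2\<bar> < \<theta>})"

definition parabolic_at_infinity :: "(complex \<Rightarrow> complex) \<Rightarrow> bool"
  where "parabolic_at_infinity \<phi> \<longleftrightarrow>
    (\<forall>\<theta>. 0 < \<theta> \<and> \<theta> < pi / 2 \<longrightarrow>
       filterlim \<phi> at_infinity (at_infinity_sector \<theta>) \<and>
       ((\<lambda>z. \<phi> z / z) \<longlongrightarrow> 1) (at_infinity_sector \<theta>))"

definition backward_iteration :: "(complex \<Rightarrow> complex) \<Rightarrow> (nat \<Rightarrow> complex) \<Rightarrow> bool"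
  where "backward_iteration \<phi> w \<longleftrightarrow>
    (\<forall>n. w n \<in> upper_half_plane) \<and> (\<forall>n. \<phi> (w (Suc n)) = w n)"

definition tau :: "(nat \<Rightarrow> complex) \<Rightarrow> nat \<Rightarrow> complex \<Rightarrow> complex"
  where "tau w n z = of_real (Re (w n)) + of_real (Im (w n)) * z"

definition translation_const :: "real \<Rightarrow> real"
  where "translation_const a = 2 * a / sqrt (1 - a\<^sup>2)"

text \<open>The limit of \<open>\<phi>\<^sub>n \<circ> \<tau>\<^sub>n\<close>, taken pointwise: wherever these maps converge
  uniformly on compact subsets of the half-plane, this is the locally uniform limit.\<close>

definition conjugating_map ::
    "(complex \<Rightarrow> complex) \<Rightarrow> (nat \<Rightarrow> complex) \<Rightarrow> complex \<Rightarrow> complex"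
  where "conjugating_map \<phi> w z = lim (\<lambda>n. (\<phi> ^^ n) (tau w n z))"

end

theory Submission
  imports Defs
begin

text \<open>
  By Julia's lemma the displacement \<open>p(z) = \<phi>(z) - z\<close> has non-negative imaginary part, so the
  Schwarz--Pick inequality yields \<open>\<bar>p(v) - p(u)\<bar> \<le> C Im p(u)\<close> on hyperbolic discs of fixed radius.
  At \<open>u = w\<^sub>n\<^sub>+\<^sub>1\<close> the right-hand side is \<open>C (y\<^sub>n - y\<^sub>n\<^sub>+\<^sub>1)\<close>, which is summable because the height is
  non-zero: near the orbit, \<open>\<phi>\<close> is a translation up to a summable error. Hence
  \<open>\<Psi>(\<zeta>) = lim \<phi>\<^sub>n(x\<^sub>n + \<zeta>\<^sub>n)\<close> exists for \<open>\<zeta>\<^sub>n \<rightarrow> \<zeta>\<close>, and \<open>\<psi>(z) = \<Psi>(l z)\<close>. For the same reason two orbits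
  keep a bounded distance once one of them is re-indexed to start near the other, so the difference
  of their real parts converges to some \<open>c\<close>; then \<open>\<Psi>\<close> also describes the second conjugating
  map, as \<open>z \<mapsto> \<Psi>(c + l' z)\<close>.
\<close>

section \<open>Pseudo-hyperbolic distance and the Schwarz-Pick inequality\<close>

lemma norm_diff_cnj_sq:
  "(cmod (v - cnj u))\<^sup>2 = (cmod (v - u))\<^sup>2 + 4 * Im u * Im v"
  unfolding cmod_power2 by (simp add: power2_eq_square algebra_simps)

lemma diff_cnj_neq_0:
  assumes "0 \<le> Im u" "0 < Im v"
  shows "v - cnj u \<noteq> 0"
  using assms by (auto simp: complex_eq_iff)

lemma pseudo_hyp_dist_less_1:
  assumes "0 < Im u" "0 < Im v"
  shows "pseudo_hyp_dist u v < 1"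
proof -
  have "(cmod (v - u))\<^sup>2 < (cmod (v - cnj u))\<^sup>2"
    using assms by (simp add: norm_diff_cnj_sq)
  then have "cmod (v - u) < cmod (v - cnj u)"
    by (rule power2_less_imp_less) simp
  then show ?thesis
    using diff_cnj_neq_0[of u v] assms by (simp add: pseudo_hyp_dist_def norm_divide)
qed

lemma pseudo_hyp_dist_nonneg: "0 \<le> pseudo_hyp_dist u v"
  by (simp add: pseudo_hyp_dist_def)

lemma pseudo_hyp_dist_le_norm:
  assumes "0 < Im u" "0 < Im v"
  shows "pseudo_hyp_dist u v \<le> cmod (v - u) / Im u"
proof -
  have "Im u \<le> Im (v - cnj u)" using assms by simp
  also have "\<dots> \<le> cmod (v - cnj u)" using abs_Im_le_cmod abs_le_D1 by blast
  finally show ?thesis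
    using assms by (simp add: pseudo_hyp_dist_def norm_divide frac_le)
qed

text \<open>With \<open>t\<close> the squared Euclidean distance, the squared pseudo-hyperbolic
  distance is \<open>t / (t + 4 * Im u * Im v)\<close>: increasing in \<open>t\<close> and
  decreasing in the heights, so \<open>t = K\<^sup>2\<close> with both heights \<open>m\<close> is
  the worst case.\<close>

lemma pseudo_hyp_dist_le_const:
  assumes "0 < m"
  shows "\<exists>r. 0 \<le> r \<and> r < 1 \<and>
    (\<forall>u v. m \<le> Im u \<longrightarrow> m \<le> Im v \<longrightarrow> cmod (v - u) \<le> K \<longrightarrow> pseudo_hyp_dist u v \<le> r)"
proof -
  define r where "r = sqrt (K\<^sup>2 / (K\<^sup>2 + 4 * m\<^sup>2))"
  have pos: "0 < K\<^sup>2 + 4 * m\<^sup>2" using assms by (intro add_nonneg_pos) auto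
  have "r < 1" unfolding r_def using pos assms by (simp add: divide_less_eq)
  moreover have "pseudo_hyp_dist u v \<le> r"
    if uv: "m \<le> Im u" "m \<le> Im v" "cmod (v - u) \<le> K" for u v
  proof -
    define t where "t = (cmod (v - u))\<^sup>2"
    have mm: "m\<^sup>2 \<le> Im u * Im v"
      unfolding power2_eq_square using uv assms by (intro mult_mono) auto
    have tK: "t \<le> K\<^sup>2" unfolding t_def using uv by (intro power_mono) auto
    have t0: "0 \<le> t" by (simp add: t_def)
    have m2: "0 < m\<^sup>2" using assms by simp
    have mI: "0 < Im u * Im v" using mm m2 by linarith
    have "(pseudo_hyp_dist u v)\<^sup>2 = t / (t + 4 * (Im u * Im v))"
      by (simp add: pseudo_hyp_dist_def norm_divide power_divide norm_diff_cnj_sq t_def mult.assoc)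
    also have "\<dots> \<le> t / (t + 4 * m\<^sup>2)"
      using mm m2 t0 mI by (intro divide_left_mono mult_pos_pos) (auto intro!: add_nonneg_pos)
    also have "\<dots> \<le> K\<^sup>2 / (K\<^sup>2 + 4 * m\<^sup>2)"
    proof -
      have "t * (4 * m\<^sup>2) \<le> K\<^sup>2 * (4 * m\<^sup>2)" using tK m2 by (intro mult_right_mono) auto
      then have "t * (K\<^sup>2 + 4 * m\<^sup>2) \<le> K\<^sup>2 * (t + 4 * m\<^sup>2)" by (simp add: algebra_simps)
      moreover have "0 < t + 4 * m\<^sup>2" using t0 m2 by linarith
      ultimately show ?thesis using pos by (simp add: divide_le_eq le_divide_eq)
    qed
    finally show ?thesis unfolding r_def by (rule real_le_rsqrt)
  qed
  moreover have "0 \<le> r" by (simp add: r_def)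
  ultimately show ?thesis by blast
qed

text \<open>Cayley transforms centred at \<open>u\<close> and at \<open>f u\<close> reduce this to
  the Schwarz lemma on the disc.\<close>

lemma schwarz_pick_upper_half_plane:
  assumes hol: "f holomorphic_on upper_half_plane"
    and pos: "\<And>z. 0 < Im z \<Longrightarrow> 0 < Im (f z)"
    and u: "0 < Im u" and v: "0 < Im v"
  shows "pseudo_hyp_dist (f u) (f v) \<le> pseudo_hyp_dist u v"
proof -
  \<comment> \<open>\<open>T\<close> inverts the Cayley transform centred at \<open>u\<close>: it
    maps the disc into the half-plane, \<open>0\<close> to \<open>u\<close>, and the point
    \<open>\<xi>\<close> below to \<open>v\<close>.\<close>
  define T where "T = (\<lambda>\<xi>. (u - cnj u * \<xi>) / (1 - \<xi>))"
  define F where "F = (\<lambda>\<xi>. (f (T \<xi>) - f u) / (f (T \<xi>) - cnj (f u)))"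
  define \<xi> where "\<xi> = (v - u) / (v - cnj u)"
  have T: "0 < Im (T z)" if "cmod z < 1" for z
  proof -
    have z1: "1 - z \<noteq> 0" using that by auto
    have "Im (T z) = Im ((u - cnj u * z) * cnj (1 - z)) / (cmod (1 - z))\<^sup>2"
      unfolding T_def by (subst complex_div_cnj) (simp add: flip: of_real_power)
    also have "Im ((u - cnj u * z) * cnj (1 - z)) = Im u * (1 - (cmod z)\<^sup>2)"
      unfolding cmod_power2 by (simp add: power2_eq_square algebra_simps)
    finally show ?thesis using z1 u that by (simp add: abs_square_less_1)
  qed
  have holF: "F holomorphic_on ball 0 1"
  proof -
    have "T holomorphic_on ball 0 1" unfolding T_def
      by (intro holomorphic_intros) auto
    moreover have "T ` ball 0 1 \<subseteq> upper_half_plane" using T by (auto simp: upper_half_plane_def)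
    ultimately have "(f \<circ> T) holomorphic_on ball 0 1"
      using hol holomorphic_on_compose_gen by blast
    then have *: "(\<lambda>x. f (T x)) holomorphic_on ball 0 1" by (simp add: o_def)
    show ?thesis unfolding F_def
      using diff_cnj_neq_0[OF less_imp_le[OF pos[OF u]] pos[OF T]]
      by (intro holomorphic_intros *) auto
  qed
  have F0: "F 0 = 0" by (simp add: F_def T_def)
  have F1: "cmod (F z) < 1" if "cmod z < 1" for z
    using pseudo_hyp_dist_less_1[OF pos[OF u] pos[OF T[OF that]]]
    by (simp add: F_def pseudo_hyp_dist_def)
  have xi: "cmod \<xi> < 1" using pseudo_hyp_dist_less_1[OF u v] by (simp add: \<xi>_def pseudo_hyp_dist_def)
  have vu: "v - cnj u \<noteq> 0" using diff_cnj_neq_0 u v by auto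
  have uu: "u - cnj u \<noteq> 0" using diff_cnj_neq_0 u by auto
  have "T \<xi> = v"
  proof -
    have "1 - \<xi> = (u - cnj u) / (v - cnj u)" using vu by (simp add: \<xi>_def field_simps)
    moreover have "u - cnj u * \<xi> = v * (u - cnj u) / (v - cnj u)"
      using vu by (simp add: \<xi>_def field_simps)
    ultimately show ?thesis using vu uu by (simp add: T_def)
  qed
  moreover have "cmod (F \<xi>) \<le> cmod \<xi>"
    using Schwarz_Lemma(1)[OF holF F0 F1 xi] by simp
  ultimately show ?thesis by (simp add: F_def \<xi>_def pseudo_hyp_dist_def)
qed

section \<open>Harnack-type estimates in the Euclidean metric\<close>

lemma norm_diff_le_of_pseudo_hyp_dist:
  assumes "0 < Im u" "0 < Im v" and d: "pseudo_hyp_dist u v \<le> r" "r < 1"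
  shows "cmod (v - u) \<le> 2 * r / (1 - r) * Im u"
proof -
  have vu: "v - cnj u \<noteq> 0" using diff_cnj_neq_0 assms by auto
  have r0: "0 \<le> r" using d pseudo_hyp_dist_nonneg order_trans by blast
  have "cmod (v - cnj u) \<le> cmod (v - u) + cmod (u - cnj u)"
    using norm_triangle_ineq[of "v - u" "u - cnj u"] by simp
  also have "cmod (u - cnj u) = 2 * Im u" using assms by (simp add: complex_diff_cnj norm_mult)
  finally have 1: "cmod (v - cnj u) \<le> cmod (v - u) + 2 * Im u" .
  have "cmod (v - u) \<le> r * cmod (v - cnj u)"
    using d vu by (simp add: pseudo_hyp_dist_def norm_divide divide_le_eq)
  also have "\<dots> \<le> r * (cmod (v - u) + 2 * Im u)" using 1 r0 by (rule mult_left_mono)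
  finally have "cmod (v - u) * (1 - r) \<le> 2 * r * Im u" by (simp add: algebra_simps)
  then show ?thesis using d by (simp add: le_divide_eq)
qed

text \<open>Schwarz-Pick controls \<open>f u\<close> and \<open>f v\<close> hyperbolically, and the
  preceding lemma makes this Euclidean. The gain is the factor \<open>Im (f u)\<close> in place of
  the modulus: for the displacement along an orbit it telescopes.\<close>

lemma harnack_norm_diff:
  assumes hol: "f holomorphic_on upper_half_plane"
    and nn: "\<And>z. 0 < Im z \<Longrightarrow> 0 \<le> Im (f z)"
    and u: "0 < Im u" and v: "0 < Im v" and d: "pseudo_hyp_dist u v \<le> r" "r < 1"
  shows "cmod (f v - f u) \<le> 2 * r / (1 - r) * Im (f u)"
proof -
  have "cmod (f v - f u) \<le> 2 * r / (1 - r) * (Im (f u) + e)" if "0 < e" for e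
  proof -
    \<comment> \<open>The perturbation covers maps touching the real axis, to which Schwarz--Pick does not apply.\<close>
    define g where "g = (\<lambda>z. f z + \<i> * of_real e)"
    have "g holomorphic_on upper_half_plane" unfolding g_def by (intro holomorphic_intros hol)
    moreover have gp: "0 < Im (g z)" if "0 < Im z" for z
      using nn[OF that] \<open>0 < e\<close> by (simp add: g_def)
    ultimately have "pseudo_hyp_dist (g u) (g v) \<le> r"
      using schwarz_pick_upper_half_plane[of g u v] u v d by force
    from norm_diff_le_of_pseudo_hyp_dist[OF gp[OF u] gp[OF v] this d(2)]
    show ?thesis by (simp add: g_def)
  qed
  then have "\<forall>\<^sub>F e in at_right 0. cmod (f v - f u) \<le> 2 * r / (1 - r) * (Im (f u) + e)"
    by (auto simp: eventually_at_right_less eventually_at_filter)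
  moreover have "((\<lambda>e. 2 * r / (1 - r) * (Im (f u) + e)) \<longlongrightarrow> 2 * r / (1 - r) * (Im (f u) + 0)) (at_right 0)"
    by (intro tendsto_intros)
  ultimately show ?thesis
    using tendsto_lowerbound[of _ _ "at_right (0::real)"] by fastforce
qed

text \<open>\<open>C\<close> is chosen before \<open>f\<close>, so that one constant serves all
  iterates of \<open>\<phi>\<close>.\<close>

lemma harnack_uniform:
  assumes "0 < m"
  shows "\<exists>C>0. \<forall>f u v. f holomorphic_on upper_half_plane \<longrightarrow> (\<forall>z. 0 < Im z \<longrightarrow> 0 \<le> Im (f z)) \<longrightarrow>
    m \<le> Im u \<longrightarrow> m \<le> Im v \<longrightarrow> cmod (v - u) \<le> K \<longrightarrow> cmod (f v - f u) \<le> C * Im (f u)"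
proof -
  obtain r where r: "0 \<le> r" "r < 1"
    "\<And>u v. m \<le> Im u \<Longrightarrow> m \<le> Im v \<Longrightarrow> cmod (v - u) \<le> K \<Longrightarrow> pseudo_hyp_dist u v \<le> r"
    using pseudo_hyp_dist_le_const[OF assms, of K] by blast
  \<comment> \<open>The summand 1 keeps the constant positive when \<open>r = 0\<close>.\<close>
  have "cmod (f v - f u) \<le> (2 * r / (1 - r) + 1) * Im (f u)"
    if "f holomorphic_on upper_half_plane" "\<forall>z. 0 < Im z \<longrightarrow> 0 \<le> Im (f z)"
      "m \<le> Im u" "m \<le> Im v" "cmod (v - u) \<le> K" for f u v
  proof -
    have "cmod (f v - f u) \<le> 2 * r / (1 - r) * Im (f u)"
      using that assms r by (intro harnack_norm_diff) auto
    moreover have "0 \<le> Im (f u)" using that assms by auto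
    ultimately show ?thesis by (simp add: distrib_right)
  qed
  moreover have "0 < 2 * r / (1 - r) + 1" using r by (intro add_nonneg_pos) auto
  ultimately show ?thesis by blast
qed

text \<open>For close points the bound is linear in \<open>cmod (v - u)\<close>, hence a Lipschitz
  estimate; the closeness condition gives \<open>r \<le> 1/2\<close>, so that
  \<open>1 / (1 - r) \<le> 2\<close>.\<close>

lemma harnack_near:
  assumes hol: "f holomorphic_on upper_half_plane"
    and nn: "\<And>z. 0 < Im z \<Longrightarrow> 0 \<le> Im (f z)"
    and u: "0 < Im u" and v: "0 < Im v" and d: "2 * cmod (v - u) \<le> Im u"
  shows "cmod (f v - f u) \<le> 4 * cmod (v - u) / Im u * Im (f u)"
proof -
  define r where "r = cmod (v - u) / Im u"
  have r: "0 \<le> r" "r \<le> 1/2" using d u by (auto simp: r_def divide_le_eq)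
  have "cmod (f v - f u) \<le> 2 * r / (1 - r) * Im (f u)"
    using r pseudo_hyp_dist_le_norm[OF u v] u v
    by (intro harnack_norm_diff hol nn) (auto simp: r_def)
  also have "2 * r / (1 - r) \<le> 4 * r"
  proof -
    have "2 * r * 1 \<le> 2 * r * (2 * (1 - r))" using r by (intro mult_left_mono) auto
    then show ?thesis using r by (simp add: divide_le_eq algebra_simps)
  qed
  finally show ?thesis using nn[OF u] by (simp add: r_def mult_right_mono)
qed

text \<open>The increments are dominated by a convergent telescoping series, so they are absolutely
  summable. In the uses \<open>y\<close> is the height along an orbit.\<close>

lemma convergent_of_telescoping_bound:
  fixes u :: "nat \<Rightarrow> 'a :: banach" and y :: "nat \<Rightarrow> real"
  assumes ev: "\<forall>\<^sub>F n in sequentially. norm (u (Suc n) - u n) \<le> C * (y n - y (Suc n))"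
    and y: "convergent y"
  shows "convergent u"
proof -
  obtain l where l: "y \<longlonglongrightarrow> l" using y by (auto simp: convergent_def)
  have "summable (\<lambda>n. C * (y n - y (Suc n)))"
    using telescope_summable'[OF l] by (intro summable_mult)
  then have "summable (\<lambda>n. u (Suc n) - u n)"
    using ev by (rule summable_comparison_test_ev[rotated])
  then have "convergent (\<lambda>n. \<Sum>k<n. u (Suc k) - u k)" by (simp add: summable_iff_convergent)
  then have "convergent (\<lambda>n. u n - u 0)" by (simp add: sum_lessThan_telescope)
  from convergent_add[OF this convergent_const[of "u 0"]] show ?thesis by simp
qed


section \<open>Julia's inequality from the angular derivative at infinity\<close>

text \<open>Schwarz-Pick cleared of denominators by \<open>norm_diff_cnj_sq\<close>, a form that can
  be rescaled as \<open>v\<close> tends to infinity.\<close>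

lemma schwarz_pick_Im:
  assumes hol: "f holomorphic_on upper_half_plane"
    and pos: "\<And>z. 0 < Im z \<Longrightarrow> 0 < Im (f z)"
    and u: "0 < Im u" and v: "0 < Im v"
  shows "Im u * Im v * (cmod (f v - cnj (f u)))\<^sup>2 \<le> Im (f u) * Im (f v) * (cmod (v - cnj u))\<^sup>2"
proof -
  define A where "A = (cmod (v - u))\<^sup>2"
  define A' where "A' = (cmod (f v - f u))\<^sup>2"
  define B where "B = Im u * Im v"
  define B' where "B' = Im (f u) * Im (f v)"
  have nn: "0 \<le> A" "0 \<le> A'" "0 < B" "0 < B'"
    using u v pos by (auto simp: A_def A'_def B_def B'_def)
  have "(pseudo_hyp_dist (f u) (f v))\<^sup>2 \<le> (pseudo_hyp_dist u v)\<^sup>2"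
    using schwarz_pick_upper_half_plane[OF assms] pseudo_hyp_dist_nonneg by (rule power_mono)
  then have "A' / (A' + 4 * B') \<le> A / (A + 4 * B)"
    by (simp add: pseudo_hyp_dist_def norm_divide power_divide norm_diff_cnj_sq
        A_def A'_def B_def B'_def mult.assoc)
  moreover have "0 < A' + 4 * B'" "0 < A + 4 * B" using nn by linarith+
  ultimately have "A' * (A + 4 * B) \<le> A * (A' + 4 * B')"
    by (simp add: divide_le_eq le_divide_eq)
  then have "B * (A' + 4 * B') \<le> B' * (A + 4 * B)" by (simp add: algebra_simps)
  then show ?thesis by (simp add: norm_diff_cnj_sq A_def A'_def B_def B'_def mult.assoc)
qed

lemma filterlim_imaginary_axis_sector:
  assumes "0 < \<theta>"
  shows "filterlim (\<lambda>t::real. \<i> * of_real t) (at_infinity_sector \<theta>) at_top"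
  unfolding at_infinity_sector_def filterlim_inf filterlim_principal
proof
  show "filterlim (\<lambda>t::real. \<i> * of_real t) at_infinity at_top"
    by (rule filterlim_norm_at_top_imp_at_infinity)
       (simp add: norm_mult filterlim_at_top_mono[OF filterlim_ident] eventually_at_top_linorder exI[of _ 0])
  have "Arg (\<i> * of_real t) = pi / 2" if "0 < t" for t :: real
    using that by (simp add: Arg_times_of_real2)
  then show "\<forall>\<^sub>F t in at_top. \<i> * of_real t \<in> {z. \<bar>Arg z - pi / 2\<bar> < \<theta>}"
    using assms by (intro eventually_mono[OF eventually_gt_at_top[of 0]]) auto
qed

text \<open>Julia's lemma at infinity: let \<open>t \<rightarrow> \<infinity>\<close> in the Schwarz--Pick inequality for \<open>z\<close> and \<open>\<i> t\<close>.\<close>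

lemma parabolic_Im_le:
  assumes self: "analytic_self_map \<phi>" and par: "parabolic_at_infinity \<phi>" and z: "0 < Im z"
  shows "Im z \<le> Im (\<phi> z)"
proof -
  \<comment> \<open>\<open>q t\<close> equals \<open>\<phi> (\<i> t) / t\<close>; written this way,
    its limit \<open>\<i>\<close> follows from the non-tangential limit 1.\<close>
  define q where "q = (\<lambda>t::real. \<i> * (\<phi> (\<i> * of_real t) / (\<i> * of_real t)))"
  have "((\<lambda>z. \<phi> z / z) \<longlongrightarrow> 1) (at_infinity_sector (pi/4))"
    using par unfolding parabolic_at_infinity_def by (auto dest: spec[of _ "pi/4"])
  then have "((\<lambda>t::real. \<phi> (\<i> * of_real t) / (\<i> * of_real t)) \<longlongrightarrow> 1) at_top"
    by (rule filterlim_compose) (simp add: filterlim_imaginary_axis_sector)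
  then have q: "(q \<longlongrightarrow> \<i> * 1) at_top" unfolding q_def by (intro tendsto_intros)
  have inv: "((\<lambda>t::real. c / of_real t) \<longlongrightarrow> 0) at_top" for c :: complex
    by (intro tendsto_divide_0[OF tendsto_const] filterlim_norm_at_top_imp_at_infinity)
       (simp add: filterlim_at_top_mono[OF filterlim_ident] eventually_at_top_linorder exI[of _ 0])
  have pos: "0 < Im (\<phi> u)" if "0 < Im u" for u
    using self that by (auto simp: analytic_self_map_def upper_half_plane_def)
  have hol: "\<phi> holomorphic_on upper_half_plane" using self by (simp add: analytic_self_map_def)
  have "((\<lambda>t. Im z * (cmod (q t - cnj (\<phi> z) / of_real t))\<^sup>2) \<longlongrightarrow> Im z * (cmod (\<i> * 1 - 0))\<^sup>2) at_top"
    by (intro tendsto_intros q inv)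
  moreover have "((\<lambda>t. Im (\<phi> z) * Im (q t) * (cmod (\<i> - cnj z / of_real t))\<^sup>2) \<longlongrightarrow>
      Im (\<phi> z) * Im (\<i> * 1) * (cmod (\<i> - 0))\<^sup>2) at_top"
    by (intro tendsto_intros q inv)
  moreover have "Im z * (cmod (q t - cnj (\<phi> z) / of_real t))\<^sup>2 \<le>
      Im (\<phi> z) * Im (q t) * (cmod (\<i> - cnj z / of_real t))\<^sup>2" if "0 < t" for t :: real
  proof -
    have 0: "Im z * t * (cmod (\<phi> (\<i> * of_real t) - cnj (\<phi> z)))\<^sup>2 \<le>
        Im (\<phi> z) * Im (\<phi> (\<i> * of_real t)) * (cmod (\<i> * of_real t - cnj z))\<^sup>2"
      using schwarz_pick_Im[OF hol pos z, of "\<i> * of_real t"] that by simp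
    have qt: "\<phi> (\<i> * of_real t) = of_real t * q t" using that by (simp add: q_def)
    have 1: "\<phi> (\<i> * of_real t) - cnj (\<phi> z) = of_real t * (q t - cnj (\<phi> z) / of_real t)"
      using that by (simp add: qt algebra_simps)
    have 2: "\<i> * of_real t - cnj z = of_real t * (\<i> - cnj z / of_real t)"
      using that by (simp add: algebra_simps)
    \<comment> \<open>Each side carries \<open>t^3\<close>: one factor from the height of
      \<open>\<i> t\<close> or of \<open>\<phi> (\<i> t)\<close>, two from the squared
      modulus.\<close>
    have "t^3 * (Im z * (cmod (q t - cnj (\<phi> z) / of_real t))\<^sup>2) \<le>
       t^3 * (Im (\<phi> z) * Im (q t) * (cmod (\<i> - cnj z / of_real t))\<^sup>2)"
      using 0 unfolding 1 2 unfolding qt norm_mult power_mult_distrib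
      by (simp add: power2_eq_square power3_eq_cube mult_ac)
    then show ?thesis using that by (simp add: mult_le_cancel_left)
  qed
  ultimately have "Im z * (cmod (\<i> * 1 - 0))\<^sup>2 \<le> Im (\<phi> z) * Im (\<i> * 1) * (cmod (\<i> - 0))\<^sup>2"
    by (intro tendsto_le[OF trivial_limit_at_top_linorder])
       (auto intro: eventually_mono[OF eventually_gt_at_top[of 0]])
  then show ?thesis by simp
qed

section \<open>Backward orbits of non-zero height\<close>

text \<open>Julia's inequality stands in for parabolicity, and real parts tending to plus infinity
  for the conditions on \<open>w\<close> and \<open>Arg\<close>. Two orbits of the same
  \<open>\<phi>\<close> are two interpretations and can be compared.\<close>

locale backward_orbit =
  fixes \<phi> :: "complex \<Rightarrow> complex" and w :: "nat \<Rightarrow> complex" and l :: real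
  assumes hol: "\<phi> holomorphic_on upper_half_plane"
    and Im_le: "\<And>z. 0 < Im z \<Longrightarrow> Im z \<le> Im (\<phi> z)"
    and phi_w: "\<And>n. \<phi> (w (Suc n)) = w n"
    and Im_w_decseq: "decseq (\<lambda>n. Im (w n))"
    and Im_w_lim: "(\<lambda>n. Im (w n)) \<longlonglongrightarrow> l"
    and l_pos: "0 < l"
    and Re_w_at_top: "filterlim (\<lambda>n. Re (w n)) at_top sequentially"
begin

lemma l_le_Im_w: "l \<le> Im (w n)"
  using Im_w_decseq Im_w_lim by (rule decseq_ge)

lemma Im_w_pos: "0 < Im (w n)"
  using l_le_Im_w[of n] l_pos by linarith

lemma iterate_w: "(\<phi> ^^ n) (w (k + n)) = w k"
  by (induction n) (auto simp: phi_w funpow_swap1)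

lemma Im_iterate_pos:
  assumes "0 < Im z" shows "0 < Im ((\<phi> ^^ n) z)"
  using assms by (induction n) (auto intro: less_le_trans Im_le)

lemma iterate_holomorphic: "(\<phi> ^^ n) holomorphic_on upper_half_plane"
proof (induction n)
  case 0 then show ?case by (simp add: id_def holomorphic_on_ident)
next
  case (Suc n)
  have "(\<phi> ^^ n) ` upper_half_plane \<subseteq> upper_half_plane"
    using Im_iterate_pos by (auto simp: upper_half_plane_def)
  then have "(\<phi> \<circ> (\<phi> ^^ n)) holomorphic_on upper_half_plane"
    using Suc hol holomorphic_on_compose_gen by blast
  then show ?case by (simp add: o_def)
qed

text \<open>\<open>harnack_uniform\<close> for the displacement, based at \<open>w (Suc n)\<close>,
  where its imaginary part is the loss of height in one step.\<close>

lemma displacement_near_orbit: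
  assumes "0 < m"
  shows "\<exists>C>0. \<forall>n v. m \<le> Im v \<longrightarrow> cmod (v - w (Suc n)) \<le> K \<longrightarrow>
    cmod (\<phi> v - v - (w n - w (Suc n))) \<le> C * (Im (w n) - Im (w (Suc n)))"
proof -
  have "0 < min m l" using assms l_pos by simp
  from harnack_uniform[OF this, of K] obtain C where C: "0 < C"
    "\<And>f u v. f holomorphic_on upper_half_plane \<Longrightarrow> (\<forall>z. 0 < Im z \<longrightarrow> 0 \<le> Im (f z)) \<Longrightarrow>
    min m l \<le> Im u \<Longrightarrow> min m l \<le> Im v \<Longrightarrow> cmod (v - u) \<le> K \<Longrightarrow> cmod (f v - f u) \<le> C * Im (f u)"
    by blast
  have "cmod (\<phi> v - v - (w n - w (Suc n))) \<le> C * (Im (w n) - Im (w (Suc n)))"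
    if "m \<le> Im v" "cmod (v - w (Suc n)) \<le> K" for n v
    using C(2)[of "\<lambda>z. \<phi> z - z" "w (Suc n)" v] that l_le_Im_w[of "Suc n"] Im_le
      holomorphic_on_diff[OF hol holomorphic_on_ident]
    by (simp add: phi_w min.coboundedI1 min.coboundedI2)
  with C(1) show ?thesis by blast
qed

text \<open>\<open>\<phi>\<close> moves the base point \<open>Re (w (Suc n)) + \<zeta>\<close> to
  \<open>Re (w n) + \<zeta>\<close> up to a multiple of \<open>s n\<close>, and the iterates are
  Lipschitz there uniformly in \<open>n\<close>; so \<open>u\<close> has summable increments. The
  variable \<open>Z\<close> absorbs the varying scale \<open>Im (w n)\<close> and, later, the offset
  of a second orbit.\<close>

lemma iterate_limit:
  assumes \<zeta>: "0 < Im \<zeta>"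
  shows "\<exists>L. \<forall>Z. Z \<longlonglongrightarrow> \<zeta> \<longrightarrow> (\<lambda>n. (\<phi> ^^ n) (of_real (Re (w n)) + Z n)) \<longlonglongrightarrow> L"
proof -
  define u where "u = (\<lambda>n. (\<phi> ^^ n) (of_real (Re (w n)) + \<zeta>))"
  define s where "s = (\<lambda>n. Im (w n) - Im (w (Suc n)))"
  define K where "K = cmod \<zeta> + Im (w 0)"
  have s: "0 \<le> s n" for n using decseq_SucD[OF Im_w_decseq, of n] by (simp add: s_def)
  have near: "cmod (of_real (Re (w n)) + \<zeta> - w n) \<le> K" for n
  proof -
    have "of_real (Re (w n)) + \<zeta> - w n = \<zeta> - \<i> * Im (w n)" by (simp add: complex_eq_iff)
    also have "cmod \<dots> \<le> cmod \<zeta> + \<bar>Im (w n)\<bar>"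
      using norm_triangle_ineq4[of \<zeta> "\<i> * Im (w n)"] by (simp add: norm_mult)
    also have "\<dots> \<le> K" using Im_w_pos[of n] decseqD[OF Im_w_decseq, of 0 n] by (simp add: K_def)
    finally show ?thesis .
  qed
  have "0 < min (Im \<zeta>) l" using \<zeta> l_pos by simp
  from harnack_uniform[OF this, of K] obtain C where C: "0 < C"
    "\<And>f u v. f holomorphic_on upper_half_plane \<Longrightarrow> (\<forall>z. 0 < Im z \<longrightarrow> 0 \<le> Im (f z)) \<Longrightarrow>
    min (Im \<zeta>) l \<le> Im u \<Longrightarrow> min (Im \<zeta>) l \<le> Im v \<Longrightarrow> cmod (v - u) \<le> K \<Longrightarrow> cmod (f v - f u) \<le> C * Im (f u)"
    by blast
  \<comment> \<open>Harnack for the \<open>n\<close>-th iterate between \<open>w n\<close> and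
    \<open>Re (w n) + \<zeta>\<close>; since that iterate sends \<open>w n\<close> to
    \<open>w 0\<close>, the bound is free of \<open>n\<close>.\<close>
  define B where "B = Im (w 0) + C * Im (w 0)"
  have B: "Im (u n) \<le> B" for n
  proof -
    have "cmod (u n - w 0) \<le> C * Im (w 0)"
      using C(2)[OF iterate_holomorphic, of n "w n" "of_real (Re (w n)) + \<zeta>"] near[of n]
        iterate_w[of n 0] l_le_Im_w[of n] Im_iterate_pos by (auto simp: u_def less_imp_le)
    then show ?thesis using abs_Im_le_cmod[of "u n - w 0"] by (simp add: B_def)
  qed
  have contract: "cmod ((\<phi> ^^ n) v - u n) \<le> 4 * B / Im \<zeta> * cmod (v - (of_real (Re (w n)) + \<zeta>))"
    if "0 < Im v" "2 * cmod (v - (of_real (Re (w n)) + \<zeta>)) \<le> Im \<zeta>" for v n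
  proof -
    have "cmod ((\<phi> ^^ n) v - u n) \<le> 4 * cmod (v - (of_real (Re (w n)) + \<zeta>)) / Im \<zeta> * Im (u n)"
      using harnack_near[OF iterate_holomorphic, of n "of_real (Re (w n)) + \<zeta>" v] that \<zeta> Im_iterate_pos
      by (auto simp: u_def less_imp_le)
    also have "\<dots> \<le> 4 * cmod (v - (of_real (Re (w n)) + \<zeta>)) / Im \<zeta> * B"
      using B \<zeta> by (intro mult_left_mono) auto
    finally show ?thesis by (simp add: mult_ac)
  qed
  have "0 \<le> B" using C Im_w_pos[of 0] by (simp add: B_def)
  have "convergent u"
  proof -
    obtain D where D: "0 < D" "\<And>n v. Im \<zeta> \<le> Im v \<Longrightarrow> cmod (v - w (Suc n)) \<le> K \<Longrightarrow>
        cmod (\<phi> v - v - (w n - w (Suc n))) \<le> D * s n"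
      using displacement_near_orbit[OF \<zeta>, of K] unfolding s_def by blast
    have diff: "cmod (\<phi> (of_real (Re (w (Suc n))) + \<zeta>) - (of_real (Re (w n)) + \<zeta>)) \<le> (D + 1) * s n" for n
    proof -
      let ?v = "of_real (Re (w (Suc n))) + \<zeta>"
      \<comment> \<open>Replacing the orbit step by its real part costs \<open>\<i> * s n\<close>,
        whence \<open>D + 1\<close> instead of \<open>D\<close>.\<close>
      have eq: "\<phi> ?v - (of_real (Re (w n)) + \<zeta>) = \<phi> ?v - ?v - (w n - w (Suc n)) + \<i> * of_real (s n)"
        by (simp add: complex_eq_iff s_def)
      have "cmod (\<phi> ?v - ?v - (w n - w (Suc n))) \<le> D * s n" using near[of "Suc n"] by (intro D(2)) auto
      moreover have "cmod (\<i> * of_real (s n)) = s n" using s[of n] by (simp add: norm_mult)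
      ultimately show ?thesis unfolding eq distrib_right
        by (intro norm_triangle_mono) auto
    qed
    have "(\<lambda>n. 2 * ((D + 1) * s n)) \<longlonglongrightarrow> 2 * ((D + 1) * (l - l))"
      unfolding s_def by (intro tendsto_intros Im_w_lim LIMSEQ_Suc)
    then have "\<forall>\<^sub>F n in sequentially. 2 * ((D + 1) * s n) < Im \<zeta>"
      using \<zeta> by (intro order_tendstoD(2)) auto
    then have "\<forall>\<^sub>F n in sequentially.
        norm (u (Suc n) - u n) \<le> 4 * B / Im \<zeta> * (D + 1) * (Im (w n) - Im (w (Suc n)))"
    proof eventually_elim
      case (elim n)
      have "0 < Im (\<phi> (of_real (Re (w (Suc n))) + \<zeta>))"
        using Im_le[of "of_real (Re (w (Suc n))) + \<zeta>"] \<zeta> by simp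
      \<comment> \<open>The left term is \<open>u (Suc n)\<close> with its innermost
        \<open>\<phi>\<close> split off, so both terms are images of nearby points under the same
        iterate.\<close>
      then have "cmod ((\<phi> ^^ n) (\<phi> (of_real (Re (w (Suc n))) + \<zeta>)) - u n) \<le>
          4 * B / Im \<zeta> * cmod (\<phi> (of_real (Re (w (Suc n))) + \<zeta>) - (of_real (Re (w n)) + \<zeta>))"
        using diff[of n] elim by (intro contract) auto
      also have "\<dots> \<le> 4 * B / Im \<zeta> * ((D + 1) * s n)"
        using diff[of n] \<zeta> \<open>0 \<le> B\<close> by (intro mult_left_mono) auto
      finally show ?case by (simp add: u_def s_def funpow_swap1 mult.assoc)
    qed
    then show ?thesis
      using convergentI[OF Im_w_lim] by (rule convergent_of_telescoping_bound)
  qed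
  then obtain L where L: "u \<longlonglongrightarrow> L" by (auto simp: convergent_def)
  have "(\<lambda>n. (\<phi> ^^ n) (of_real (Re (w n)) + Z n)) \<longlonglongrightarrow> L" if Z: "Z \<longlonglongrightarrow> \<zeta>" for Z
  proof -
    have 0: "(\<lambda>n. cmod (Z n - \<zeta>)) \<longlonglongrightarrow> 0"
      using Z by (simp add: LIM_zero tendsto_norm_zero)
    have "\<forall>\<^sub>F n in sequentially. cmod (Z n - \<zeta>) < Im \<zeta> / 2"
      using 0 \<zeta> by (intro order_tendstoD(2)) auto
    moreover have "\<forall>\<^sub>F n in sequentially. 0 < Im (Z n)"
      using tendsto_Im[OF Z] \<zeta> by (intro order_tendstoD(1)) auto
    ultimately have "\<forall>\<^sub>F n in sequentially.
        norm ((\<phi> ^^ n) (of_real (Re (w n)) + Z n) - u n) \<le> 4 * B / Im \<zeta> * cmod (Z n - \<zeta>)"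
    proof eventually_elim
      case (elim n)
      then show ?case using contract[of "of_real (Re (w n)) + Z n" n] by simp
    qed
    moreover have "(\<lambda>n. 4 * B / Im \<zeta> * cmod (Z n - \<zeta>)) \<longlonglongrightarrow> 0"
      using tendsto_mult_left[OF 0, of "4 * B / Im \<zeta>"] by simp
    ultimately have "(\<lambda>n. (\<phi> ^^ n) (of_real (Re (w n)) + Z n) - u n) \<longlonglongrightarrow> 0"
      by (rule Lim_null_comparison)
    from tendsto_add[OF this L] show ?thesis by simp
  qed
  then show ?thesis by blast
qed

text \<open>The sign of the steps is at stake. Consecutive steps differ by at most
  \<open>C * s n\<close>, which tends to 0, while their size stays above \<open>\<beta> / 2\<close>;
  so the sign freezes, and a negative one would keep the real parts bounded above.\<close>

lemma Re_step_lim: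
  assumes abs: "(\<lambda>n. \<bar>Re (w (Suc n)) - Re (w n)\<bar>) \<longlonglongrightarrow> \<beta>" and \<beta>: "0 < \<beta>"
  shows "(\<lambda>n. Re (w (Suc n)) - Re (w n)) \<longlonglongrightarrow> \<beta>"
proof -
  define dx where "dx = (\<lambda>n. Re (w (Suc n)) - Re (w n))"
  define s where "s = (\<lambda>n. Im (w n) - Im (w (Suc n)))"
  have s: "0 \<le> s n" for n using decseq_SucD[OF Im_w_decseq, of n] by (simp add: s_def)
  obtain K where K: "\<And>n. \<bar>dx n\<bar> \<le> K"
    using Bseq_eq_bounded[THEN iffD1, OF convergent_imp_Bseq[OF convergentI[OF abs]]]
    by (auto simp: dx_def bounded_iff)
  have step: "cmod (w (Suc (Suc n)) - w (Suc n)) \<le> K + Im (w 0)" for n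
  proof -
    have "cmod (w (Suc (Suc n)) - w (Suc n)) \<le> \<bar>dx (Suc n)\<bar> + \<bar>s (Suc n)\<bar>"
      using cmod_le[of "w (Suc (Suc n)) - w (Suc n)"] by (simp add: dx_def s_def abs_minus_commute)
    also have "\<dots> \<le> K + Im (w 0)"
      using K[of "Suc n"] s[of "Suc n"] Im_w_pos[of "Suc (Suc n)"] decseqD[OF Im_w_decseq, of 0 "Suc n"]
      by (simp add: s_def)
    finally show ?thesis .
  qed
  obtain C where C: "0 < C" "\<And>n v. l \<le> Im v \<Longrightarrow> cmod (v - w (Suc n)) \<le> K + Im (w 0) \<Longrightarrow>
      cmod (\<phi> v - v - (w n - w (Suc n))) \<le> C * s n"
    using displacement_near_orbit[OF l_pos, of "K + Im (w 0)"] unfolding s_def by blast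
  have ddx: "\<bar>dx (Suc n) - dx n\<bar> \<le> C * s n" for n
  proof -
    have "\<bar>Re (\<phi> (w (Suc (Suc n))) - w (Suc (Suc n)) - (w n - w (Suc n)))\<bar> \<le> C * s n"
      using C(2)[OF l_le_Im_w step] abs_Re_le_cmod order_trans by blast
    then show ?thesis by (simp add: phi_w dx_def abs_minus_commute algebra_simps)
  qed
  have "(\<lambda>n. C * s n) \<longlonglongrightarrow> C * (l - l)"
    unfolding s_def by (intro tendsto_intros Im_w_lim LIMSEQ_Suc)
  then have "\<forall>\<^sub>F n in sequentially. C * s n < \<beta> / 2"
    using \<beta> by (intro order_tendstoD(2)) auto
  moreover have "\<forall>\<^sub>F n in sequentially. \<beta> / 2 < \<bar>dx n\<bar>"
    using abs \<beta> unfolding dx_def by (intro order_tendstoD(1)) auto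
  ultimately have "\<forall>\<^sub>F n in sequentially. C * s n < \<beta> / 2 \<and> \<beta> / 2 < \<bar>dx n\<bar>"
    by eventually_elim auto
  then obtain N where N: "\<And>n. N \<le> n \<Longrightarrow> C * s n < \<beta> / 2 \<and> \<beta> / 2 < \<bar>dx n\<bar>"
    by (auto simp: eventually_sequentially)
  have "0 \<le> dx n0" if n0: "N \<le> n0" for n0
  proof (rule ccontr)
    assume neg: "\<not> 0 \<le> dx n0"
    have *: "dx (n0 + k) < 0 \<and> Re (w (n0 + k)) \<le> Re (w n0)" for k
    proof (induction k)
      case (Suc k)
      then show ?case using N[of "n0 + k"] n0 ddx[of "n0 + k"] by (auto simp: dx_def)
    qed (use neg in auto)
    obtain n where "n0 \<le> n" "Re (w n0) < Re (w n)"
      using Re_w_at_top[unfolded filterlim_at_top_dense, rule_format, of "Re (w n0)"]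
      by (auto simp: eventually_sequentially) (meson nle_le)
    then show False using *[of "n - n0"] by simp
  qed
  then have "\<forall>\<^sub>F n in sequentially. \<bar>dx n\<bar> = dx n"
    by (intro eventually_sequentiallyI[of N]) simp
  with abs show ?thesis
    unfolding dx_def by (rule Lim_transform_eventually)
qed

text \<open>The index is the one just before the first passage beyond \<open>X\<close>.\<close>

lemma exists_orbit_point_near:
  assumes K: "\<And>n. \<bar>Re (w (Suc n)) - Re (w n)\<bar> \<le> K" and X: "Re (w M) \<le> X"
  shows "\<exists>m\<ge>M. Re (w m) \<le> X \<and> X \<le> Re (w m) + K"
proof -
  obtain k where "X < Re (w (M + k))"
    using Re_w_at_top[unfolded filterlim_at_top_dense, rule_format, of X]
    by (auto simp: eventually_sequentially) (meson le_add2)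
  then have ex: "\<exists>k. X < Re (w (M + k))" by blast
  define k where "k = (LEAST k. X < Re (w (M + k)))"
  have k: "X < Re (w (M + k))" unfolding k_def using ex by (rule LeastI_ex)
  then obtain j where j: "k = Suc j" using X by (cases k) auto
  have "\<not> X < Re (w (M + j))" using not_less_Least[of j "\<lambda>k. X < Re (w (M + k))"] j by (simp flip: k_def)
  then show ?thesis using k K[of "M + j"] j by (intro exI[of _ "M + j"]) auto
qed

lemma Re_shift_lim:
  assumes dx: "(\<lambda>n. Re (w (Suc n)) - Re (w n)) \<longlonglongrightarrow> \<beta>"
  shows "(\<lambda>n. Re (w (n + k)) - Re (w n)) \<longlonglongrightarrow> real k * \<beta>"
proof (induction k)
  case (Suc k)
  have "(\<lambda>n. (Re (w (Suc (n + k))) - Re (w (n + k))) + (Re (w (n + k)) - Re (w n))) \<longlonglongrightarrow> \<beta> + real k * \<beta>"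
    by (intro tendsto_add Suc LIMSEQ_ignore_initial_segment[OF dx])
  then show ?case by (simp add: distrib_right)
qed simp

text \<open>Pair \<open>w' (N + j)\<close> with \<open>w (m + j)\<close>, starting within
  \<open>K\<close> of each other. While the gap stays below \<open>K + 1\<close> its total drift is
  less than 1, so it never leaves that range and it converges; the index shift is undone at the
  end.\<close>

lemma convergent_Re_diff:
  assumes "backward_orbit \<phi> w' l'"
    and dx: "(\<lambda>n. Re (w (Suc n)) - Re (w n)) \<longlonglongrightarrow> \<beta>"
    and dx': "(\<lambda>n. Re (w' (Suc n)) - Re (w' n)) \<longlonglongrightarrow> \<beta>'"
  shows "convergent (\<lambda>n. Re (w' n) - Re (w n))"
proof -
  interpret w': backward_orbit \<phi> w' l' by fact
  define s where "s = (\<lambda>n. Im (w n) - Im (w (Suc n)))"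
  obtain K where K: "\<And>n. \<bar>Re (w (Suc n)) - Re (w n)\<bar> \<le> K"
    using Bseq_eq_bounded[THEN iffD1, OF convergent_imp_Bseq[OF convergentI[OF dx]]]
    by (auto simp: bounded_iff)
  obtain K' where K': "\<And>n. \<bar>Re (w' (Suc n)) - Re (w' n)\<bar> \<le> K'"
    using Bseq_eq_bounded[THEN iffD1, OF convergent_imp_Bseq[OF convergentI[OF dx']]]
    by (auto simp: bounded_iff)
  \<comment> \<open>\<open>K + 1\<close> for the gap, \<open>K\<close> and \<open>K'\<close> for one
    further step on each orbit, and the initial heights for the imaginary parts.\<close>
  define R where "R = K + 1 + K + K' + Im (w 0) + Im (w' 0)"
  obtain C where C: "0 < C" "\<And>n v. l' \<le> Im v \<Longrightarrow> cmod (v - w (Suc n)) \<le> R \<Longrightarrow>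
      cmod (\<phi> v - v - (w n - w (Suc n))) \<le> C * s n"
    using displacement_near_orbit[OF w'.l_pos, of R] unfolding s_def by blast
  have "(\<lambda>n. C * (Im (w n) - l)) \<longlonglongrightarrow> C * (l - l)" by (intro tendsto_intros Im_w_lim)
  then have "\<forall>\<^sub>F n in sequentially. C * (Im (w n) - l) < 1"
    by (intro order_tendstoD(2)) auto
  then obtain M where M: "\<And>m. M \<le> m \<Longrightarrow> C * (Im (w m) - l) < 1"
    by (auto simp: eventually_sequentially)
  obtain N where "Re (w M) < Re (w' N)"
    using w'.Re_w_at_top[unfolded filterlim_at_top_dense, rule_format, of "Re (w M)"]
    by (auto simp: eventually_sequentially)
  then obtain m where m: "M \<le> m" "Re (w m) \<le> Re (w' N)" "Re (w' N) \<le> Re (w m) + K"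
    using exists_orbit_point_near[OF K, of M "Re (w' N)"] by auto
  define \<delta> where "\<delta> = (\<lambda>j. Re (w' (N + j)) - Re (w (m + j)))"
  have step: "\<bar>\<delta> (Suc j) - \<delta> j\<bar> \<le> C * s (m + j)" if "\<bar>\<delta> j\<bar> \<le> K + 1" for j
  proof -
    let ?v = "w' (Suc (N + j))" and ?u = "w (Suc (m + j))"
    have "\<bar>Re ?v - Re ?u\<bar> \<le> K + 1 + K + K'"
      using that K[of "m + j"] K'[of "N + j"] unfolding \<delta>_def by linarith
    moreover have "\<bar>Im ?v - Im ?u\<bar> \<le> Im (w 0) + Im (w' 0)"
      using Im_w_pos[of "Suc (m + j)"] w'.Im_w_pos[of "Suc (N + j)"]
        decseqD[OF Im_w_decseq, of 0 "Suc (m + j)"] decseqD[OF w'.Im_w_decseq, of 0 "Suc (N + j)"]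
      by simp
    ultimately have "cmod (?v - ?u) \<le> R"
      using cmod_le[of "?v - ?u"] by (simp add: R_def)
    then have "\<bar>Re (\<phi> ?v - ?v - (w (m + j) - ?u))\<bar> \<le> C * s (m + j)"
      using C(2)[OF w'.l_le_Im_w] abs_Re_le_cmod order_trans by blast
    then show ?thesis by (simp add: w'.phi_w \<delta>_def abs_minus_commute algebra_simps)
  qed
  have bound: "\<bar>\<delta> j\<bar> \<le> K + C * (Im (w m) - Im (w (m + j)))" for j
  proof (induction j)
    case 0
    then show ?case using m by (simp add: \<delta>_def)
  next
    case (Suc j)
    have "C * (Im (w m) - Im (w (m + j))) \<le> C * (Im (w m) - l)"
      using C l_le_Im_w by (intro mult_left_mono) auto
    then have "\<bar>\<delta> j\<bar> \<le> K + 1" using Suc M[OF m(1)] by linarith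
    from step[OF this] Suc show ?case by (simp add: s_def algebra_simps)
  qed
  have "convergent \<delta>"
  proof (rule convergent_of_telescoping_bound)
    have "\<bar>\<delta> j\<bar> \<le> K + 1" for j
    proof -
      have "C * (Im (w m) - Im (w (m + j))) \<le> C * (Im (w m) - l)"
        using C l_le_Im_w by (intro mult_left_mono) auto
      then show ?thesis using bound[of j] M[OF m(1)] by linarith
    qed
    then show "\<forall>\<^sub>F j in sequentially. norm (\<delta> (Suc j) - \<delta> j) \<le> C * (Im (w (m + j)) - Im (w (m + Suc j)))"
      using step by (simp add: s_def)
    show "convergent (\<lambda>j. Im (w (m + j)))"
      using LIMSEQ_ignore_initial_segment[OF Im_w_lim, of m] by (auto simp: convergent_def add.commute)
  qed
  \<comment> \<open>Correction for the re-indexing: added to \<open>\<delta> j\<close> it leaves the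
    gap at the common index \<open>N + j\<close>.\<close>
  moreover have "convergent (\<lambda>j. Re (w (m + j)) - Re (w (N + j)))"
  proof -
    have "(\<lambda>j. Re (w (m + j)) - Re (w j)) \<longlonglongrightarrow> real m * \<beta>"
      using Re_shift_lim[OF dx, of m] by (simp add: add.commute)
    moreover have "(\<lambda>j. Re (w (N + j)) - Re (w j)) \<longlonglongrightarrow> real N * \<beta>"
      using Re_shift_lim[OF dx, of N] by (simp add: add.commute)
    ultimately have "(\<lambda>j. (Re (w (m + j)) - Re (w j)) - (Re (w (N + j)) - Re (w j))) \<longlonglongrightarrow> real m * \<beta> - real N * \<beta>"
      by (rule tendsto_diff)
    then show ?thesis by (auto simp: convergent_def)
  qed
  ultimately have "convergent (\<lambda>j. \<delta> j + (Re (w (m + j)) - Re (w (N + j))))"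
    by (rule convergent_add)
  then have "convergent (\<lambda>j. Re (w' (j + N)) - Re (w (j + N)))"
    by (simp add: \<delta>_def add.commute)
  then show ?thesis
    by (rule convergent_ignore_initial_segment[THEN iffD1])
qed

end

section \<open>From the hypotheses on a sequence to the orbit locale\<close>

text \<open>Solve the formula for the squared distance for the squared Euclidean step and subtract
  the vertical part. The distance does not see the direction, hence the absolute value.\<close>

lemma abs_Re_step_lim:
  assumes pos: "\<And>n. 0 < Im (w n)"
    and d: "(\<lambda>n. pseudo_hyp_dist (w n) (w (Suc n))) \<longlonglongrightarrow> a" and a: "0 \<le> a" "a < 1"
    and Im: "(\<lambda>n. Im (w n)) \<longlonglongrightarrow> l" and l: "0 < l"
  shows "(\<lambda>n. \<bar>Re (w (Suc n)) - Re (w n)\<bar>) \<longlonglongrightarrow> l * translation_const a"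
proof -
  define D where "D = (\<lambda>n. (pseudo_hyp_dist (w n) (w (Suc n)))\<^sup>2)"
  have a2: "a\<^sup>2 < 1" using a by (simp add: abs_square_less_1)
  have eq: "\<bar>Re (w (Suc n)) - Re (w n)\<bar> =
    sqrt (4 * Im (w n) * Im (w (Suc n)) * D n / (1 - D n) - (Im (w (Suc n)) - Im (w n))\<^sup>2)" for n
  proof -
    define X where "X = (cmod (w (Suc n) - w n))\<^sup>2"
    define Y where "Y = 4 * Im (w n) * Im (w (Suc n))"
    have "0 < Y" "0 \<le> X" using pos by (auto simp: Y_def X_def)
    moreover have "D n = X / (X + Y)"
      by (simp add: D_def pseudo_hyp_dist_def norm_divide power_divide norm_diff_cnj_sq X_def Y_def)
    ultimately have "D n = X / (X + Y)" "1 - D n = Y / (X + Y)" "0 < Y" "0 < X + Y"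
      by (auto simp: field_simps)
    then have "Y * D n / (1 - D n) = X" by simp
    moreover have "X = (Re (w (Suc n)) - Re (w n))\<^sup>2 + (Im (w (Suc n)) - Im (w n))\<^sup>2"
      unfolding X_def cmod_power2 by simp
    ultimately show ?thesis by (simp add: Y_def)
  qed
  have "(\<lambda>n. sqrt (4 * Im (w n) * Im (w (Suc n)) * D n / (1 - D n) - (Im (w (Suc n)) - Im (w n))\<^sup>2))
    \<longlonglongrightarrow> sqrt (4 * l * l * a\<^sup>2 / (1 - a\<^sup>2) - (l - l)\<^sup>2)"
    unfolding D_def using a2 by (intro tendsto_intros d Im LIMSEQ_Suc[OF Im]) auto
  also have "sqrt (4 * l * l * a\<^sup>2 / (1 - a\<^sup>2) - (l - l)\<^sup>2) = sqrt ((2 * l * a)\<^sup>2 / (1 - a\<^sup>2))"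
    by (simp add: power_mult_distrib power2_eq_square mult_ac)
  also have "\<dots> = l * translation_const a"
    using l a by (simp add: translation_const_def real_sqrt_divide)
  finally show ?thesis by (simp add: eq)
qed

lemma step_limit_pos:
  assumes pos: "\<And>n. 0 < Im (w n)" and inf: "filterlim w at_infinity sequentially"
    and inc: "incseq (\<lambda>n. pseudo_hyp_dist (w n) (w (Suc n)))"
    and d: "(\<lambda>n. pseudo_hyp_dist (w n) (w (Suc n))) \<longlonglongrightarrow> a"
  shows "0 < a"
proof (rule ccontr)
  assume "\<not> 0 < a"
  then have "pseudo_hyp_dist (w n) (w (Suc n)) = 0" for n
    using incseq_le[OF inc d, of n] pseudo_hyp_dist_nonneg[of "w n" "w (Suc n)"] by linarith
  \<comment> \<open>The second case comes from division by zero having value 0; the half-plane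
    excludes it.\<close>
  then have "w (Suc n) = w n \<or> w (Suc n) - cnj (w n) = 0" for n
    by (simp add: pseudo_hyp_dist_def)
  then have "w (Suc n) = w n" for n
    using diff_cnj_neq_0[OF less_imp_le[OF pos[of n]] pos[of "Suc n"]] by blast
  then have "w n = w 0" for n by (induction n) auto
  then have "w = (\<lambda>_. w 0)" by auto
  then have "w \<longlonglongrightarrow> w 0" by (metis tendsto_const)
  then show False using not_tendsto_and_filterlim_at_infinity[OF sequentially_bot _ inf] by blast
qed

text \<open>Bounded height forces the real part to be large in modulus, and a small argument makes
  it non-negative.\<close>

lemma Re_at_top_of_Arg:
  assumes inf: "filterlim w at_infinity sequentially" and Arg: "(\<lambda>n. Arg (w n)) \<longlonglongrightarrow> 0"
    and Im: "(\<lambda>n. Im (w n)) \<longlonglongrightarrow> l"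
  shows "filterlim (\<lambda>n. Re (w n)) at_top sequentially"
  unfolding filterlim_at_top
proof
  fix Z :: real
  have "filterlim (\<lambda>n. cmod (w n)) at_top sequentially"
    using inf by (rule filterlim_at_infinity_imp_norm_at_top)
  then have 1: "\<forall>\<^sub>F n in sequentially. \<bar>Z\<bar> + (\<bar>l\<bar> + 1) \<le> cmod (w n)"
    by (simp add: filterlim_at_top)
  have 2: "\<forall>\<^sub>F n in sequentially. \<bar>Im (w n)\<bar> < \<bar>l\<bar> + 1"
    using tendsto_rabs[OF Im] by (intro order_tendstoD(2)) auto
  have 3: "\<forall>\<^sub>F n in sequentially. Arg (w n) < pi / 2"
    using Arg by (intro order_tendstoD(2)) auto
  have 4: "\<forall>\<^sub>F n in sequentially. - (pi / 2) < Arg (w n)"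
    using Arg by (intro order_tendstoD(1)) auto
  from 1 2 3 4 show "\<forall>\<^sub>F n in sequentially. Z \<le> Re (w n)"
  proof eventually_elim
    case (elim n)
    have "w n \<noteq> 0" using elim by auto
    have "Re (w n) = Re (cmod (w n) * exp (\<i> * Arg (w n)))"
      using Arg_eq[OF \<open>w n \<noteq> 0\<close>] by simp
    also have "\<dots> = cmod (w n) * cos (Arg (w n))" by (simp add: Re_exp)
    finally have "0 \<le> Re (w n)" using elim cos_gt_zero_pi[of "Arg (w n)"] by simp
    then show ?case using elim cmod_le[of "w n"] by linarith
  qed
qed

lemma backward_orbitI:
  assumes self: "analytic_self_map \<phi>" and par: "parabolic_at_infinity \<phi>"
    and bi: "backward_iteration \<phi> w" and inf: "filterlim w at_infinity sequentially"
    and inc: "incseq (\<lambda>n. pseudo_hyp_dist (w n) (w (Suc n)))"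
    and d: "(\<lambda>n. pseudo_hyp_dist (w n) (w (Suc n))) \<longlonglongrightarrow> a" and "a < 1"
    and dec: "decseq (\<lambda>n. Im (w n))" and Im: "(\<lambda>n. Im (w n)) \<longlonglongrightarrow> l" and "l > 0"
    and Arg: "(\<lambda>n. Arg (w n)) \<longlonglongrightarrow> 0"
  shows "backward_orbit \<phi> w l" and "0 < translation_const a"
    and "(\<lambda>n. Re (w (Suc n)) - Re (w n)) \<longlonglongrightarrow> l * translation_const a"
proof -
  have pos: "0 < Im (w n)" for n
    using bi by (simp add: backward_iteration_def upper_half_plane_def)
  show orbit: "backward_orbit \<phi> w l"
    using assms Re_at_top_of_Arg[OF inf Arg Im] parabolic_Im_le[OF self par]
    by unfold_locales (auto simp: analytic_self_map_def backward_iteration_def)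
  have "0 < a" by (rule step_limit_pos[OF pos inf inc d])
  then show b: "0 < translation_const a"
    using \<open>a < 1\<close> by (simp add: translation_const_def abs_square_less_1)
  show "(\<lambda>n. Re (w (Suc n)) - Re (w n)) \<longlonglongrightarrow> l * translation_const a"
    using \<open>0 < a\<close> \<open>a < 1\<close> \<open>l > 0\<close> b
    by (intro backward_orbit.Re_step_lim[OF orbit] abs_Re_step_lim[OF pos d _ _ Im]) auto
qed

section \<open>Comparison of the two conjugating maps\<close>

theorem theorem1p14:
  fixes \<phi> :: "complex \<Rightarrow> complex" and w w' :: "nat \<Rightarrow> complex" and a a' l l' :: real
  assumes "analytic_self_map \<phi>" and "parabolic_at_infinity \<phi>"
    and "backward_iteration \<phi> w" and "filterlim w at_infinity sequentially"
    and "incseq (\<lambda>n. pseudo_hyp_dist (w n) (w (Suc n)))"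
    and "(\<lambda>n. pseudo_hyp_dist (w n) (w (Suc n))) \<longlonglongrightarrow> a" and "a < 1"
    and "decseq (\<lambda>n. Im (w n))" and "(\<lambda>n. Im (w n)) \<longlonglongrightarrow> l" and "l > 0"
    and "(\<lambda>n. Arg (w n)) \<longlonglongrightarrow> 0"
    and "backward_iteration \<phi> w'" and "filterlim w' at_infinity sequentially"
    and "incseq (\<lambda>n. pseudo_hyp_dist (w' n) (w' (Suc n)))"
    and "(\<lambda>n. pseudo_hyp_dist (w' n) (w' (Suc n))) \<longlonglongrightarrow> a'" and "a' < 1"
    and "decseq (\<lambda>n. Im (w' n))" and "(\<lambda>n. Im (w' n)) \<longlonglongrightarrow> l'" and "l' > 0"
    and "(\<lambda>n. Arg (w' n)) \<longlonglongrightarrow> 0"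
  shows "let b0 = translation_const a; b0' = translation_const a';
             \<psi> = conjugating_map \<phi> w; \<psi>' = conjugating_map \<phi> w'
         in (\<exists>b1::real.
               (\<forall>z\<in>upper_half_plane. \<psi>' (of_real (b0' / b0) * z + of_real b1) = \<psi> z) \<and>
               (let z1 = of_real (b0 / b0') * (\<i> - of_real b1)
                in \<forall>n. w' n = \<psi> (z1 + of_nat n * of_real b0))) \<and>
            (\<lambda>n. Re (w (Suc n)) - Re (w n)) \<longlonglongrightarrow> l * b0 \<and>
            l * b0 = l' * b0' \<and>
            (\<lambda>n. Re (w' (Suc n)) - Re (w' n)) \<longlonglongrightarrow> l' * b0'"
proof -
  define b where "b = translation_const a"
  define b' where "b' = translation_const a'"
  interpret w: backward_orbit \<phi> w l
    by (rule backward_orbitI(1)[OF assms(1-11)])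
  interpret w': backward_orbit \<phi> w' l'
    by (rule backward_orbitI(1)[OF assms(1-2,12-)])
  have b: "0 < b" and dx: "(\<lambda>n. Re (w (Suc n)) - Re (w n)) \<longlonglongrightarrow> l * b"
    unfolding b_def by (rule backward_orbitI[OF assms(1-11)])+
  have b': "0 < b'" and dx': "(\<lambda>n. Re (w' (Suc n)) - Re (w' n)) \<longlonglongrightarrow> l' * b'"
    unfolding b'_def by (rule backward_orbitI[OF assms(1-2,12-)])+
  obtain c where c: "(\<lambda>n. Re (w' n) - Re (w n)) \<longlonglongrightarrow> c"
    using w.convergent_Re_diff[OF w'.backward_orbit_axioms dx dx'] by (auto simp: convergent_def)
  \<comment> \<open>The increments of the convergent gap tend to 0 and also to the difference of the
    two step limits.\<close>
  have lb: "l * b = l' * b'"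
  proof -
    have "(\<lambda>n. (Re (w' (Suc n)) - Re (w' n)) - (Re (w (Suc n)) - Re (w n))) \<longlonglongrightarrow> l' * b' - l * b"
      by (intro tendsto_diff dx dx')
    moreover have "(\<lambda>n. (Re (w' (Suc n)) - Re (w (Suc n))) - (Re (w' n) - Re (w n))) \<longlonglongrightarrow> c - c"
      by (intro tendsto_diff c LIMSEQ_Suc)
    moreover have "(\<lambda>n. (Re (w' (Suc n)) - Re (w (Suc n))) - (Re (w' n) - Re (w n))) =
        (\<lambda>n. (Re (w' (Suc n)) - Re (w' n)) - (Re (w (Suc n)) - Re (w n)))"
      by (auto simp: algebra_simps)
    ultimately show ?thesis using LIMSEQ_unique by fastforce
  qed
  obtain \<Psi> where \<Psi>: "\<And>\<zeta> Z. 0 < Im \<zeta> \<Longrightarrow> Z \<longlonglongrightarrow> \<zeta> \<Longrightarrow>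
      (\<lambda>n. (\<phi> ^^ n) (of_real (Re (w n)) + Z n)) \<longlonglongrightarrow> \<Psi> \<zeta>"
    using w.iterate_limit by metis
  have \<psi>: "conjugating_map \<phi> w z = \<Psi> (of_real l * z)" if "0 < Im z" for z
    unfolding conjugating_map_def tau_def using that w.l_pos
    by (intro limI \<Psi> tendsto_intros w.Im_w_lim) auto
  \<comment> \<open>The maps \<open>tau w' n\<close> are rewritten over the base points
    \<open>Re (w n)\<close> of the first orbit, so that the same \<open>\<Psi>\<close>
    applies.\<close>
  have \<psi>': "conjugating_map \<phi> w' z = \<Psi> (of_real c + of_real l' * z)" if "0 < Im z" for z
  proof -
    have "(\<lambda>n. (\<phi> ^^ n) (of_real (Re (w n)) + (of_real (Re (w' n) - Re (w n)) + of_real (Im (w' n)) * z)))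
        \<longlonglongrightarrow> \<Psi> (of_real c + of_real l' * z)"
      using that w'.l_pos by (intro \<Psi> tendsto_intros w'.Im_w_lim c) auto
    then show ?thesis unfolding conjugating_map_def tau_def by (intro limI) simp
  qed
  \<comment> \<open>\<open>w' k\<close> is the image of \<open>w' (n + k)\<close> under the
    \<open>n\<close>-th iterate for every \<open>n\<close>: a constant sequence, whose limit
    \<open>\<Psi>\<close> computes.\<close>
  have w': "w' k = \<Psi> (of_real (c + real k * (l' * b')) + of_real l' * \<i>)" for k
  proof -
    have "(\<lambda>n. (Re (w' n) - Re (w n)) + (Re (w' (n + k)) - Re (w' n))) \<longlonglongrightarrow> c + real k * (l' * b')"
      by (intro tendsto_add c w'.Re_shift_lim dx')
    then have "(\<lambda>n. Re (w' (n + k)) - Re (w n)) \<longlonglongrightarrow> c + real k * (l' * b')" by simp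
    moreover have "(\<lambda>n. Im (w' (n + k))) \<longlonglongrightarrow> l'"
      by (rule LIMSEQ_ignore_initial_segment[OF w'.Im_w_lim])
    ultimately have "(\<lambda>n. (\<phi> ^^ n) (of_real (Re (w n)) +
        (of_real (Re (w' (n + k)) - Re (w n)) + of_real (Im (w' (n + k))) * \<i>)))
        \<longlonglongrightarrow> \<Psi> (of_real (c + real k * (l' * b')) + of_real l' * \<i>)"
      using w'.l_pos by (intro \<Psi> tendsto_add tendsto_mult tendsto_of_real tendsto_const) auto
    moreover have "of_real (Re (w n)) + (of_real (Re (w' (n + k)) - Re (w n))
        + of_real (Im (w' (n + k))) * \<i>) = w' (k + n)" for n
      by (simp add: complex_eq_iff add.commute)
    ultimately show ?thesis by (simp add: w'.iterate_w tendsto_const_iff)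
  qed
  \<comment> \<open>Chosen so that \<open>c + l' * b1 = 0\<close>; the scale \<open>b' / b\<close>
    then matches because \<open>l * b = l' * b'\<close>.\<close>
  define b1 where "b1 = - c / l'"
  have l: "l = l' * b' / b" using lb b by (simp add: field_simps)
  have "conjugating_map \<phi> w' (of_real (b' / b) * z + of_real b1) = conjugating_map \<phi> w z"
    if "0 < Im z" for z
  proof -
    have "of_real c + of_real l' * (of_real (b' / b) * z + of_real b1) = of_real l * z"
      using w'.l_pos b by (simp add: b1_def l field_simps)
    then show ?thesis using that b b' by (simp add: \<psi> \<psi>')
  qed
  moreover have "w' n = conjugating_map \<phi> w (of_real (b / b') * (\<i> - of_real b1) + of_nat n * of_real b)" for n
  proof -
    have "of_real l * (of_real (b / b') * (\<i> - of_real b1) + of_nat n * of_real b) =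
        of_real (c + real n * (l' * b')) + of_real l' * \<i>"
      using w'.l_pos b b' by (simp add: b1_def l field_simps)
    then show ?thesis using b b' by (simp add: \<psi> w')
  qed
  ultimately show ?thesis
    using dx dx' lb unfolding Let_def b_def[symmetric] b'_def[symmetric]
    by (auto simp: upper_half_plane_def intro!: exI[of _ b1])
qed

end
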